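(* Let $\mathcal{X}\subseteq\{0,1\}^n$ be the feasible set of a combinatorial problem $\mathcal{P}$, let $\Xi\subseteq\mathbb{R}^n_+$ be convex, closed and bounded, let $\hat{\pmb{\xi}}_1,\dots,\hat{\pmb{\xi}}_N\in\Xi$ with $\widehat{\mathbb{P}}^N=(\hat{\pmb{\xi}}_1,\dots,\hat{\pmb{\xi}}_N)$, let $\epsilon\ge0$, $q\in[1,\infty]$, and let $\alpha\in(\frac{l-1}N,\frac lN]$ for some $l\in\{1,\dots,N\}$. Let $\overline{\pmb{\xi}}$ maximize $\pmb{1}^T\pmb{\xi}$ over $\pmb{\xi}\in\Xi$, where $\pmb{1}=(1,\dots,1)^T$. Let $c\ge1$ be the smallest constant such that $$\|\overline{\pmb{\xi}}-\hat{\pmb{\xi}}_i\|_q\le c\,\frac{\epsilon N}{l},\qquad i=1,\dots,N,$$ and define $\mathbb{P}'^N=(\pmb{\xi}'_1,\dots,\pmb{\xi}'_N)$ by $\pmb{\xi}'_i=\hat{\pmb{\xi}}_i+\frac{\overline{\pmb{\xi}}-\hat{\pmb{\xi}}_i}{c}$. Let $\pmb{\zeta}=(\zeta_1,\dots,\zeta_n)$, where $\zeta_j=\max_{\pmb{\xi}\in\Xi}\xi_j$. If $\pmb{x}'\in\mathcal{X}$ minimizes ${\rm CVaR}^{\alpha}_{\mathbb{P}'^N}[\tilde{\pmb{\xi}}^T\pmb{x}]$ over $\pmb{x}\in\mathcal{X}$ and $\pmb{\zeta}^T\pmb{x}'\le b\cdot\overline{\pmb{\xi}}^T\pmb{x}'$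 for some constant $b\ge1$, then $\pmb{x}'$ is a $(b\cdot c)$-approximate solution to $\textsc{Distr}\ \mathcal{P}$.
   Context: The notation $\mathbb{P}^N=(\pmb{\xi}_1,\dots,\pmb{\xi}_N)$ denotes the discrete distribution $\frac1N\sum_{i=1}^N\delta_{\pmb{\xi}_i}$ (repetitions allowed), $\tilde{\pmb{\xi}}$ is a random vector with the distribution indicated in the subscript, and ${\rm CVaR}^{\alpha}_{\mathbb{P}^N}[\tilde{\pmb{\xi}}^T\pmb{x}]=\inf_{t\in\mathbb{R}}\big(t+\frac1{\alpha N}\sum_{i=1}^N\max\{0,\pmb{\xi}_i^T\pmb{x}-t\}\big)$. The constant $c$ is assumed to exist (this is automatic if $\epsilon>0$). The ambiguity set is $$\mathcal{B}_{\epsilon}(\widehat{\mathbb{P}}^N)=\Big\{(\pmb{\xi}_1,\dots,\pmb{\xi}_N):\ \sum_{i=1}^N\|\pmb{\xi}_i-\hat{\pmb{\xi}}_i\|_q\le N\epsilon,\ \pmb{\xi}_i\in\Xi,\ i=1,\dots,N\Big\}.$$ $\textsc{Distr}\ \mathcal{P}$ is the problem $\min_{\pmb{x}\in\mathcal{X}}F(\pmb{x})$ with $F(\pmb{x})=\max_{\mathbb{P}^N\in\mathcal{B}_\epsilon(\widehat{\mathbb{P}}^N)}{\rm CVaR}^{\alpha}_{\mathbb{P}^N}[\tilde{\pmb{\xi}}^T\pmb{x}]$. A solution $\pmb{x}'\in\mathcal{X}$ is $\rho$-approximate if $F(\pmb{x}')\le\rho\,\min_{\pmb{x}\in\mathcal{X}}F(\pmb{x})$.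 *)

theory Defs
  imports "HOL-Analysis.Analysis"
begin

text \<open>
  Scenarios are indexed by a finite type \<open>'m\<close> with \<open>N = CARD('m)\<close>; a map
  \<open>P :: 'm \<Rightarrow> real ^ 'n\<close> stands for the discrete distribution giving mass \<open>1/N\<close> to each
  \<open>P i\<close> (repetitions allowed).
\<close>

definition lq_norm :: "ereal \<Rightarrow> real ^ 'n \<Rightarrow> real" where
  "lq_norm q x =
    (if q = \<infinity> then infnorm x
     else (\<Sum>j\<in>UNIV. \<bar>x $ j\<bar> powr real_of_ereal q) powr (1 / real_of_ereal q))"

text \<open>The infimum is over a set that is bounded below whenever \<open>0 < \<alpha> \<le> 1\<close>.\<close>

definition cvar :: "real \<Rightarrow> ('m::finite \<Rightarrow> real ^ 'n) \<Rightarrow> real ^ 'n \<Rightarrow> real" where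
  "cvar \<alpha> P x =
    (INF t::real. t + 1 / (\<alpha> * real CARD('m)) * (\<Sum>i\<in>UNIV. max 0 (P i \<bullet> x - t)))"

definition ambiguity_set ::
  "ereal \<Rightarrow> real \<Rightarrow> (real ^ 'n) set \<Rightarrow> ('m::finite \<Rightarrow> real ^ 'n) \<Rightarrow> ('m \<Rightarrow> real ^ 'n) set" where
  "ambiguity_set q \<epsilon> \<Xi> P =
    {Q. (\<Sum>i\<in>UNIV. lq_norm q (Q i - P i)) \<le> real CARD('m) * \<epsilon> \<and> (\<forall>i. Q i \<in> \<Xi>)}"

text \<open>
  The maximum over the ambiguity set is written as a supremum; for compact \<open>\<Xi>\<close>, \<open>\<epsilon> \<ge> 0\<close> and
  \<open>0 < \<alpha> \<le> 1\<close>, with \<open>P\<close> supported in \<open>\<Xi>\<close>, the two coincide.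
\<close>

definition distr_obj ::
  "ereal \<Rightarrow> real \<Rightarrow> (real ^ 'n) set \<Rightarrow> ('m::finite \<Rightarrow> real ^ 'n) \<Rightarrow> real \<Rightarrow> real ^ 'n \<Rightarrow> real" where
  "distr_obj q \<epsilon> \<Xi> P \<alpha> x = (SUP Q\<in>ambiguity_set q \<epsilon> \<Xi> P. cvar \<alpha> Q x)"

text \<open>Used only for finite \<open>X\<close>, so that \<open>Min\<close> is the minimum of \<open>F\<close> over \<open>X\<close>.\<close>

definition approx_solution :: "real \<Rightarrow> ('a \<Rightarrow> real) \<Rightarrow> 'a set \<Rightarrow> 'a \<Rightarrow> bool" where
  "approx_solution \<rho> F X x \<longleftrightarrow> x \<in> X \<and> F x \<le> \<rho> * Min (F ` X)"

end

theory Submission imports Defs begin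

text \<open>
  Only the \<open>l\<close> largest values of \<open>P' i \<bullet> x\<close> enter CVaR at level \<open>\<alpha> \<le> l / N\<close>. Moving just these
  \<open>l\<close> scenarios from \<open>P_hat i\<close> to \<open>P' i\<close> costs at most \<open>l \<cdot> \<epsilon> N / l = N \<epsilon>\<close>, so
  \<open>CVaR P' x \<le> F x\<close> for every \<open>x\<close>. Conversely \<open>P' i \<ge> \<xi>_bar / c\<close> componentwise, while every scenario
  in \<open>\<Xi>\<close> is at most \<open>\<zeta>\<close>, so that
  \<open>F x' \<le> \<zeta> \<bullet> x' \<le> b (\<xi>_bar \<bullet> x') \<le> b c CVaR P' x' \<le> b c CVaR P' x \<le> b c F x\<close>.
\<close>

section \<open>Norms, componentwise order, and selection of largest values\<close>

lemma lq_norm_zero [simp]: "lq_norm q 0 = 0"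
  by (simp add: lq_norm_def infnorm_0)

text \<open>Prices the partial move from \<open>P_hat i\<close> towards \<open>\<xi>_bar\<close>.
  The assumption on \<open>q\<close> excludes \<open>-\<infinity>\<close> and lets the exponents
  \<open>r\<close> and \<open>1 / r\<close> cancel.\<close>

lemma lq_norm_scaleR:
  assumes "1 \<le> q"
  shows "lq_norm q (a *\<^sub>R v) = \<bar>a\<bar> * lq_norm q v"
proof (cases q)
  case (real r)
  with assms have "1 \<le> r" by simp
  have "(\<Sum>j\<in>UNIV. \<bar>a * v $ j\<bar> powr r) = \<bar>a\<bar> powr r * (\<Sum>j\<in>UNIV. \<bar>v $ j\<bar> powr r)"
    by (simp add: abs_mult powr_mult sum_distrib_left)
  with \<open>1 \<le> r\<close> real show ?thesis
    by (simp add: lq_norm_def powr_mult powr_powr sum_nonneg)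
qed (use assms in \<open>auto simp: lq_norm_def infnorm_mul\<close>)

lemma inner_mono_vec:
  fixes u v x :: "real ^ 'n"
  assumes "\<And>j. u $ j \<le> v $ j" and "\<And>j. 0 \<le> x $ j"
  shows "u \<bullet> x \<le> v \<bullet> x"
  unfolding inner_vec_def by (intro sum_mono) (simp add: assms mult_right_mono)

text \<open>Greedy selection: a maximiser of \<open>v\<close> on \<open>A - S\<close> joins
  \<open>S\<close>, dominating what remains while the earlier members still do. Ties are broken
  arbitrarily.\<close>

lemma obtain_largest_values:
  fixes v :: "'a \<Rightarrow> 'b::linorder"
  assumes "finite A" and "l \<le> card A"
  obtains S where "S \<subseteq> A" and "card S = l"
    and "\<And>i j. i \<in> S \<Longrightarrow> j \<in> A - S \<Longrightarrow> v j \<le> v i"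
proof -
  have "\<exists>S\<subseteq>A. card S = l \<and> (\<forall>i\<in>S. \<forall>j\<in>A - S. v j \<le> v i)"
    using assms(2)
  proof (induction l)
    case 0
    show ?case by (intro exI[of _ "{}"]) simp
  next
    case (Suc l)
    then obtain S where S: "S \<subseteq> A" "card S = l" "\<forall>i\<in>S. \<forall>j\<in>A - S. v j \<le> v i"
      by auto
    have fin: "finite S" "finite (A - S)"
      using S(1) assms(1) by (auto intro: finite_subset)
    have "A - S \<noteq> {}"
      using S(1,2) Suc.prems by auto
    then have "Max (v ` (A - S)) \<in> v ` (A - S)"
      using fin by simp
    then obtain k where k: "k \<in> A - S" "v k = Max (v ` (A - S))"
      by auto
    have "v j \<le> v k" if "j \<in> A - S" for j
      using that fin by (simp add: k(2))
    then show ?case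
      using S k(1) fin by (intro exI[of _ "insert k S"]) auto
  qed
  then show thesis using that by blast
qed

section \<open>Bounds on CVaR\<close>

context
  fixes \<alpha> :: real
  assumes \<alpha>_bounds: "0 < \<alpha>" "\<alpha> \<le> 1"
begin

text \<open>Every excess is at least \<open>max 0 (k - t)\<close>, and
  \<open>1 / \<alpha> \<ge> 1\<close>, so the weighted mean excess makes up for
  \<open>k - t\<close>. Being uniform in \<open>t\<close>, the bound also shows that the infimum is
  over a set bounded below.\<close>

lemma cvar_integrand_ge:
  fixes P :: "'m::finite \<Rightarrow> real ^ 'n"
  assumes "\<And>i. k \<le> P i \<bullet> x"
  shows "k \<le> t + 1 / (\<alpha> * real CARD('m)) * (\<Sum>i\<in>UNIV. max 0 (P i \<bullet> x - t))"
proof -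
  have "real CARD('m) * max 0 (k - t) = (\<Sum>i\<in>(UNIV::'m set). max 0 (k - t))"
    by simp
  also have "\<dots> \<le> (\<Sum>i\<in>UNIV. max 0 (P i \<bullet> x - t))"
    by (intro sum_mono max.mono diff_right_mono assms order_refl)
  finally have "real CARD('m) * max 0 (k - t) / (\<alpha> * real CARD('m))
      \<le> (\<Sum>i\<in>UNIV. max 0 (P i \<bullet> x - t)) / (\<alpha> * real CARD('m))"
    using \<alpha>_bounds by (intro divide_right_mono) auto
  moreover have "k - t \<le> max 0 (k - t) / \<alpha>"
  proof -
    have "max 0 (k - t) * \<alpha> \<le> max 0 (k - t) * 1"
      using \<alpha>_bounds by (intro mult_left_mono) auto
    then have "max 0 (k - t) \<le> max 0 (k - t) / \<alpha>"
      using \<alpha>_bounds(1) by (subst pos_le_divide_eq) simp_all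
    then show ?thesis by linarith
  qed
  ultimately show ?thesis by simp
qed

lemma cvar_ge:
  fixes P :: "'m::finite \<Rightarrow> real ^ 'n"
  assumes "\<And>i. k \<le> P i \<bullet> x"
  shows "k \<le> cvar \<alpha> P x"
  unfolding cvar_def by (rule cINF_greatest, simp) (rule cvar_integrand_ge[OF assms])

lemma cvar_le_integrand:
  fixes P :: "'m::finite \<Rightarrow> real ^ 'n"
  shows "cvar \<alpha> P x \<le> t + 1 / (\<alpha> * real CARD('m)) * (\<Sum>i\<in>UNIV. max 0 (P i \<bullet> x - t))"
  unfolding cvar_def
proof (rule cINF_lower)
  show "bdd_below (range (\<lambda>t. t + 1 / (\<alpha> * real CARD('m)) * (\<Sum>i\<in>UNIV. max 0 (P i \<bullet> x - t))))"
    by (rule bdd_belowI2[of _ "Min (range (\<lambda>i. P i \<bullet> x))"]) (rule cvar_integrand_ge, simp)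
qed simp

lemma cvar_le:
  fixes P :: "'m::finite \<Rightarrow> real ^ 'n"
  assumes "\<And>i. P i \<bullet> x \<le> k"
  shows "cvar \<alpha> P x \<le> k"
  \<comment> \<open>At \<open>t = k\<close> every excess vanishes.\<close>
  using cvar_le_integrand[of P x k] assms by simp

text \<open>Let \<open>g t\<close> be the CVaR objective of \<open>P\<close> with the sum restricted
  to \<open>S\<close>. It lies below the objective of \<open>Q\<close>, since the terms on
  \<open>S\<close> agree and the others are nonnegative. It also never drops below
  \<open>cvar \<alpha> P x\<close>.\<close>

lemma cvar_le_if_agree_on_largest:
  fixes P Q :: "'m::finite \<Rightarrow> real ^ 'n"
  assumes "S \<noteq> {}" and card: "\<alpha> * real CARD('m) \<le> real (card S)"
    and top: "\<And>i j. i \<in> S \<Longrightarrow> j \<notin> S \<Longrightarrow> P j \<bullet> x \<le> P i \<bullet> x"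
    and agree: "\<And>i. i \<in> S \<Longrightarrow> Q i = P i"
  shows "cvar \<alpha> P x \<le> cvar \<alpha> Q x"
proof -
  \<comment> \<open>The threshold \<open>m\<close> separates \<open>S\<close> from its complement:
    for \<open>t \<ge> m\<close> no scenario outside \<open>S\<close> has positive excess.\<close>
  define m where "m = Min ((\<lambda>i. P i \<bullet> x) ` S)"
  define K where "K = 1 / (\<alpha> * real CARD('m))"
  have K: "0 < K" "1 \<le> K * real (card S)"
    using \<alpha>_bounds card by (auto simp: K_def)
  have m_le: "m \<le> P i \<bullet> x" if "i \<in> S" for i
    using that by (simp add: m_def)
  have "m \<in> (\<lambda>i. P i \<bullet> x) ` S"
    using \<open>S \<noteq> {}\<close> by (simp add: m_def)
  then have le_m: "P j \<bullet> x \<le> m" if "j \<notin> S" for j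
    using top that by auto
  have P_sum: "(\<Sum>i\<in>UNIV. max 0 (P i \<bullet> x - t)) = (\<Sum>i\<in>S. max 0 (P i \<bullet> x - t))" if "m \<le> t" for t
    by (rule sum.mono_neutral_right) (use le_m that in \<open>force+\<close>)
  have Q_sum: "(\<Sum>i\<in>S. max 0 (P i \<bullet> x - t)) \<le> (\<Sum>i\<in>UNIV. max 0 (Q i \<bullet> x - t))" for t
  proof -
    have "(\<Sum>i\<in>S. max 0 (P i \<bullet> x - t)) = (\<Sum>i\<in>S. max 0 (Q i \<bullet> x - t))"
      by (simp add: agree)
    also have "\<dots> \<le> (\<Sum>i\<in>UNIV. max 0 (Q i \<bullet> x - t))"
      by (rule sum_mono2) auto
    finally show ?thesis .
  qed
  have "cvar \<alpha> P x \<le> t + K * (\<Sum>i\<in>S. max 0 (P i \<bullet> x - t))" for t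
  proof (cases "m \<le> t")
    case True
    with cvar_le_integrand[of P x t] show ?thesis
      by (simp add: P_sum K_def)
  next
    \<comment> \<open>Below \<open>m\<close> all excesses on \<open>S\<close> are active, so
      \<open>g\<close> is affine there with slope \<open>1 - K * card S \<le> 0\<close>; hence
      \<open>g t \<ge> g m\<close>.\<close>
    case False
    have "cvar \<alpha> P x \<le> m + K * (\<Sum>i\<in>S. max 0 (P i \<bullet> x - m))"
      using cvar_le_integrand[of P x m] by (simp add: P_sum K_def)
    also have "(\<Sum>i\<in>S. max 0 (P i \<bullet> x - m)) = (\<Sum>i\<in>S. max 0 (P i \<bullet> x - t) - (m - t))"
      using m_le False by (intro sum.cong) force+
    also have "\<dots> = (\<Sum>i\<in>S. max 0 (P i \<bullet> x - t)) - real (card S) * (m - t)"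
      by (simp add: sum_subtractf)
    also have "m + K * \<dots> \<le> t + K * (\<Sum>i\<in>S. max 0 (P i \<bullet> x - t))"
      using mult_right_mono[OF K(2), of "m - t"] False by (simp add: algebra_simps)
    finally show ?thesis .
  qed
  also have "t + K * (\<Sum>i\<in>S. max 0 (P i \<bullet> x - t)) \<le> t + K * (\<Sum>i\<in>UNIV. max 0 (Q i \<bullet> x - t))" for t
    using K(1) Q_sum by simp
  finally show ?thesis
    unfolding cvar_def[of _ Q] K_def by (intro cINF_greatest) auto
qed

end

section \<open>Comparison of \<open>P'\<close> with the worst case over the ambiguity set\<close>

theorem theorem4:
  fixes X :: "(real ^ 'n) set"
    and \<Xi> :: "(real ^ 'n) set"
    and P_hat P' :: "'m::finite \<Rightarrow> real ^ 'n"
    and \<xi>_bar \<zeta> x' :: "real ^ 'n"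
    and \<epsilon> \<alpha> c b :: real
    and q :: ereal
    and l :: nat
  assumes X_binary: "X \<subseteq> {x. \<forall>j. x $ j \<in> {0, 1}}"
    and Xi_nonneg: "\<Xi> \<subseteq> {\<xi>. \<forall>j. 0 \<le> \<xi> $ j}"
    and Xi: "convex \<Xi>" "closed \<Xi>" "bounded \<Xi>"
    and P_hat: "\<And>i. P_hat i \<in> \<Xi>"
    and \<epsilon>: "0 \<le> \<epsilon>"
    and q: "1 \<le> q"
    and l: "l \<in> {1..CARD('m)}"
    and \<alpha>: "\<alpha> \<in> {(real l - 1) / real CARD('m) <.. real l / real CARD('m)}"
    and \<xi>_bar: "is_arg_max (\<lambda>\<xi>. 1 \<bullet> \<xi>) (\<lambda>\<xi>. \<xi> \<in> \<Xi>) \<xi>_bar"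
    and c: "is_arg_min (\<lambda>c. c)
              (\<lambda>c. 1 \<le> c \<and>
                (\<forall>i. lq_norm q (\<xi>_bar - P_hat i) \<le> c * (\<epsilon> * real CARD('m) / real l))) c"
    and P': "\<And>i. P' i = P_hat i + (\<xi>_bar - P_hat i) /\<^sub>R c"
    and \<zeta>: "\<And>j. \<zeta> $ j = (SUP \<xi>\<in>\<Xi>. \<xi> $ j)"
    and x': "is_arg_min (cvar \<alpha> P') (\<lambda>x. x \<in> X) x'"
    and b: "1 \<le> b" "\<zeta> \<bullet> x' \<le> b * (\<xi>_bar \<bullet> x')"
  shows "approx_solution (b * c) (distr_obj q \<epsilon> \<Xi> P_hat \<alpha>) X x'"
proof -
  have N: "0 < real CARD('m)" and l': "1 \<le> real l" "real l \<le> real CARD('m)"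
    using l by auto
  \<comment> \<open>The lower endpoint \<open>(l - 1) / N\<close> is nonnegative because
    \<open>l \<ge> 1\<close>.\<close>
  have \<alpha>_pos: "0 < \<alpha>"
    using \<alpha> l' N by (smt (verit) divide_nonneg_pos greaterThanAtMost_iff)
  have \<alpha>_le: "\<alpha> * real CARD('m) \<le> real l"
    using \<alpha> N by (simp add: pos_le_divide_eq)
  have \<alpha>_le1: "\<alpha> \<le> 1"
  proof -
    have "real l / real CARD('m) \<le> 1" using l' N by simp
    moreover have "\<alpha> \<le> real l / real CARD('m)" using \<alpha> by simp
    ultimately show ?thesis by (rule order_trans[rotated])
  qed
  have bar: "\<xi>_bar \<in> \<Xi>"
    using \<xi>_bar by (simp add: is_arg_max_def)
  have c1: "1 \<le> c"
    and c_le: "\<And>i. lq_norm q (\<xi>_bar - P_hat i) \<le> c * (\<epsilon> * real CARD('m) / real l)"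
    using c by (auto simp: is_arg_min_def)
  have x'X: "x' \<in> X" and x'_min: "\<And>x. x \<in> X \<Longrightarrow> cvar \<alpha> P' x' \<le> cvar \<alpha> P' x"
    using x' by (auto simp: is_arg_min_def not_less)
  have X_nonneg: "0 \<le> x $ j" if "x \<in> X" for x j
  proof -
    have "x $ j = 0 \<or> x $ j = 1" using X_binary that by blast
    then show ?thesis by auto
  qed
  \<comment> \<open>Finiteness makes \<open>Min\<close> in \<open>approx_solution\<close> an
    attained minimum.\<close>
  have fin: "finite X"
  proof (rule finite_subset)
    have "{x :: real ^ 'n. \<forall>j. x $ j \<in> {0, 1}} \<subseteq> vec_lambda ` (UNIV \<rightarrow>\<^sub>E {0, 1})"
    proof
      fix x :: "real ^ 'n" assume "x \<in> {x. \<forall>j. x $ j \<in> {0, 1}}"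
      then show "x \<in> vec_lambda ` (UNIV \<rightarrow>\<^sub>E {0, 1})"
        by (intro image_eqI[of _ _ "($) x"]) (auto simp: PiE_def)
    qed
    with X_binary show "X \<subseteq> vec_lambda ` (UNIV \<rightarrow>\<^sub>E {0, 1})"
      by (rule order_trans)
    show "finite (vec_lambda ` ((UNIV :: 'n set) \<rightarrow>\<^sub>E {0, 1 :: real}))"
      by (intro finite_imageI finite_PiE) auto
  qed
  have \<zeta>_ge: "\<xi> $ j \<le> \<zeta> $ j" if "\<xi> \<in> \<Xi>" for \<xi> j
    unfolding \<zeta>
  proof (rule cSUP_upper[OF that])
    obtain B where "\<And>\<xi>. \<xi> \<in> \<Xi> \<Longrightarrow> norm \<xi> \<le> B"
      using Xi(3) by (auto simp: bounded_iff)
    then show "bdd_above ((\<lambda>\<xi>. \<xi> $ j) ` \<Xi>)"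
      by (intro bdd_aboveI2[of _ _ B]) (smt (verit) component_le_norm_cart)
  qed
  \<comment> \<open>This bound serves twice: it makes the supremum in \<open>distr_obj\<close>
    bounded above, and it estimates that supremum at \<open>x'\<close>.\<close>
  have cvar_le_\<zeta>: "cvar \<alpha> Q x \<le> \<zeta> \<bullet> x" if "x \<in> X" "Q \<in> ambiguity_set q \<epsilon> \<Xi> P_hat" for Q x
    using that by (intro cvar_le[OF \<alpha>_pos \<alpha>_le1] inner_mono_vec \<zeta>_ge X_nonneg)
      (auto simp: ambiguity_set_def)
  \<comment> \<open>As \<open>c \<ge> 1\<close>, this is a convex combination, which puts
    \<open>P' i\<close> in \<open>\<Xi>\<close>; its first summand is nonnegative, which later
    leaves \<open>\<xi>_bar / c\<close> as a lower bound.\<close>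
  have P'_convex: "P' i = (1 - 1 / c) *\<^sub>R P_hat i + (1 / c) *\<^sub>R \<xi>_bar" for i
    by (simp add: P' algebra_simps divide_inverse)
  have P'_Xi: "P' i \<in> \<Xi>" for i
    unfolding P'_convex using c1 by (intro convexD[OF Xi(1) P_hat bar]) auto
  have P'_dist: "lq_norm q (P' i - P_hat i) \<le> \<epsilon> * real CARD('m) / real l" for i
  proof -
    have "lq_norm q (P' i - P_hat i) = lq_norm q (\<xi>_bar - P_hat i) / c"
      using c1 by (simp add: P' lq_norm_scaleR[OF q] divide_inverse_commute del: scaleR_diff_right)
    also have "\<dots> \<le> \<epsilon> * real CARD('m) / real l"
      using c_le[of i] c1 by (subst pos_divide_le_eq) (simp_all add: mult.commute)
    finally show ?thesis .
  qed
  have P_hat_amb: "P_hat \<in> ambiguity_set q \<epsilon> \<Xi> P_hat"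
    using \<epsilon> P_hat by (simp add: ambiguity_set_def)
  have lower: "cvar \<alpha> P' x \<le> distr_obj q \<epsilon> \<Xi> P_hat \<alpha> x" if "x \<in> X" for x
  proof -
    have "l \<le> card (UNIV :: 'm set)" using l by simp
    then obtain S where S: "card S = l" "\<And>i j. i \<in> S \<Longrightarrow> j \<in> UNIV - S \<Longrightarrow> P' j \<bullet> x \<le> P' i \<bullet> x"
      by (rule obtain_largest_values[OF finite, where v = "\<lambda>i. P' i \<bullet> x"]) blast
    \<comment> \<open>\<open>S\<close> and \<open>Q\<close> may depend on \<open>x\<close>, since
      the supremum in \<open>distr_obj\<close> is taken for each \<open>x\<close>
      separately.\<close>
    define Q where "Q i = (if i \<in> S then P' i else P_hat i)" for i
    have "(\<Sum>i\<in>UNIV. lq_norm q (Q i - P_hat i)) = (\<Sum>i\<in>S. lq_norm q (P' i - P_hat i))"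
      by (rule sum.mono_neutral_cong_right) (auto simp: Q_def)
    also have "\<dots> \<le> (\<Sum>i\<in>S. \<epsilon> * real CARD('m) / real l)"
      by (intro sum_mono P'_dist)
    also have "\<dots> = real CARD('m) * \<epsilon>"
      using l' S(1) by simp
    finally have Q: "Q \<in> ambiguity_set q \<epsilon> \<Xi> P_hat"
      using P_hat P'_Xi by (simp add: ambiguity_set_def Q_def)
    have "cvar \<alpha> P' x \<le> cvar \<alpha> Q x"
    proof (rule cvar_le_if_agree_on_largest[OF \<alpha>_pos \<alpha>_le1])
      show "S \<noteq> {}" using S(1) l by auto
      show "\<alpha> * real CARD('m) \<le> real (card S)" using S(1) \<alpha>_le by simp
    qed (use S(2) in \<open>auto simp: Q_def\<close>)
    also have "\<dots> \<le> distr_obj q \<epsilon> \<Xi> P_hat \<alpha> x"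
      unfolding distr_obj_def
      using cvar_le_\<zeta>[OF that] by (intro cSUP_upper[OF Q] bdd_aboveI2)
    finally show ?thesis .
  qed
  have "\<xi>_bar \<bullet> x' / c \<le> cvar \<alpha> P' x'"
  proof (rule cvar_ge[OF \<alpha>_pos \<alpha>_le1])
    fix i
    have "((1 / c) *\<^sub>R \<xi>_bar) \<bullet> x' \<le> P' i \<bullet> x'"
    proof (rule inner_mono_vec)
      fix j
      have "0 \<le> P_hat i $ j" using P_hat Xi_nonneg by blast
      then show "((1 / c) *\<^sub>R \<xi>_bar) $ j \<le> P' i $ j"
        using c1 by (simp add: P'_convex)
    qed (rule X_nonneg[OF x'X])
    then show "\<xi>_bar \<bullet> x' / c \<le> P' i \<bullet> x'" by simp
  qed
  then have bar_le: "\<xi>_bar \<bullet> x' \<le> c * cvar \<alpha> P' x'"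
    using c1 by (simp add: pos_divide_le_eq mult.commute)
  have \<zeta>_le: "\<zeta> \<bullet> x' \<le> b * c * cvar \<alpha> P' x'"
  proof -
    have "b * (\<xi>_bar \<bullet> x') \<le> b * (c * cvar \<alpha> P' x')"
      using b(1) bar_le by (intro mult_left_mono) auto
    with b(2) show ?thesis by (simp add: mult.assoc)
  qed
  have "distr_obj q \<epsilon> \<Xi> P_hat \<alpha> x' \<le> b * c * distr_obj q \<epsilon> \<Xi> P_hat \<alpha> x" if "x \<in> X" for x
  proof -
    have "distr_obj q \<epsilon> \<Xi> P_hat \<alpha> x' \<le> \<zeta> \<bullet> x'"
      unfolding distr_obj_def using P_hat_amb cvar_le_\<zeta>[OF x'X] by (intro cSUP_least) auto
    also note \<zeta>_le
    also have "b * c * cvar \<alpha> P' x' \<le> b * c * distr_obj q \<epsilon> \<Xi> P_hat \<alpha> x"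
      using b c1 x'_min[OF that] lower[OF that] by (intro mult_left_mono) auto
    finally show ?thesis .
  qed
  \<comment> \<open>The minimum is the value at some \<open>x \<in> X\<close>, to which the
    preceding estimate applies.\<close>
  moreover have "Min (distr_obj q \<epsilon> \<Xi> P_hat \<alpha> ` X) \<in> distr_obj q \<epsilon> \<Xi> P_hat \<alpha> ` X"
    using fin x'X by (intro Min_in) auto
  ultimately show ?thesis
    using x'X by (auto simp: approx_solution_def)
qed

end
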